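(* Let $\epsilon>0$. For every adaptive backtracking (BT) algorithm $\mathcal{A}$ that solves the Simple Knapsack Problem exactly, and for all sufficiently large $n$, there is an instance with $n$ items (and a suitably large capacity $N$) on which the computation tree $T_{\mathcal{A}}(I)$ has width at least $\Omega\big(2^{(0.694-\epsilon)n}/\sqrt{n}\big)$. In other words, the time complexity of any adaptive BT algorithm for Simple Knapsack on $n$ items is $\Omega\big(2^{(0.694-\epsilon)n}/\sqrt{n}\big)$.
   Context: Simple Knapsack Problem: input is $n$ non-negative integers $x_1,\dots,x_n$ (each item's weight equals its value) and a positive integer $N$; output is $S\subseteq\{1,\dots,n\}$ maximizing $\sum_{i\in S}x_i$ subject to $\sum_{i\in S}x_i\le N$. Backtracking (BT) model: a data domain $\mathcal{D}$ of data items (here, the possible item values) and a decision set $H=\{0,1\}$ (reject/accept an item). For a set $S$, $\mathcal{O}(S)$ denotes the set of orderings of elements of $S$. A BT algorithm $\mathcal{A}$ consists of ordering functions $r^k_{\mathcal{A}}:\mathcal{D}^k\times H^k\to\mathcal{O}(\mathcal{D})$ and choice functions $c^k_{\mathcal{A}}:\mathcal{D}^{k+1}\times H^k\to\mathcal{O}(H\cup\{\perp\})$, $k=0,\dots,n-1$. It is adaptive if $r^k_{\mathcal{A}}$ depends on the data items $D_1,\dots,D_k$ but not on the decisions $a_1,\dots,a_k$. For an instance $I=(D_1,\dots,D_n)$, the computation tree $T_{\mathcal{A}}(I)$ is the rooted tree defined recursively: each node $v$ at depth $k$ is labelled by $(D^v_1,\dots,D^v_k,a^v_1,\dots,a^v_k)$;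 the root has the empty label; for a node $v$ of depth $k<n$, let $D^v_{k+1}$ be the item of $I\setminus\{D^v_1,\dots,D^v_k\}$ that comes first in $r^k_{\mathcal{A}}(\vec D^v,\vec a^v)$, and if $c^k_{\mathcal{A}}(\vec D^v,D^v_{k+1},\vec a^v)=(c_1,\dots,c_d,\perp,\dots)$ with $c_i\in H$, then $v$ has $d$ children with labels $(D^v_1,\dots,D^v_{k+1},a^v_1,\dots,a^v_k,c_i)$ (no children if $d=0$). The algorithm solves the problem exactly if for every instance some depth-$n$ node of the tree carries an optimal assignment. The width of the computation tree (maximum number of nodes at a single depth) is taken as a lower bound on the time complexity of the algorithm. *)

theory Defs
  imports Complex_Main "HOL-Library.Multiset"
begin

section \<open>Backtracking algorithms\<close>

text \<open>
  Data items are the elements of \<^typ>\<open>'d\<close>, decisions those of \<^typ>\<open>'h\<close>. The families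
  indexed by k are given as functions on lists: a k-tuple is a list of length k. A pair
  (x, y) in an item order means that x comes no later than y. The data domain may be infinite,
  so an ordering of it is an arbitrary linear order; an ordering of the decisions together with
  the bottom symbol is a duplicate-free list, in which \<^const>\<open>None\<close> is the bottom symbol.
\<close>

record ('d, 'h) bt_algorithm =
  item_order :: "'d list \<Rightarrow> 'h list \<Rightarrow> 'd rel"
  decision_order :: "'d list \<Rightarrow> 'd \<Rightarrow> 'h list \<Rightarrow> 'h option list"

definition is_bt_algorithm :: "nat \<Rightarrow> ('d, 'h) bt_algorithm \<Rightarrow> bool" where
  "is_bt_algorithm n A \<longleftrightarrow>
     (\<forall>ds as. length ds < n \<and> length as = length ds \<longrightarrow>
        linear_order (item_order A ds as) \<and>
        (\<forall>d. distinct (decision_order A ds d as) \<and> set (decision_order A ds d as) = UNIV))"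

definition adaptive :: "nat \<Rightarrow> ('d, 'h) bt_algorithm \<Rightarrow> bool" where
  "adaptive n A \<longleftrightarrow>
     (\<forall>ds as as'. length ds < n \<and> length as = length ds \<and> length as' = length ds \<longrightarrow>
        item_order A ds as = item_order A ds as')"

definition comes_first :: "'d rel \<Rightarrow> 'd set \<Rightarrow> 'd \<Rightarrow> bool" where
  "comes_first r S d \<longleftrightarrow> d \<in> S \<and> (\<forall>y\<in>S. (d, y) \<in> r)"

text \<open>
  The nodes of the computation tree, identified with their labels; this is harmless because a
  label determines the path from the root. An instance may contain the same item several times,
  so the items not yet seen are obtained by multiset difference.
\<close>

inductive_set computation_tree ::
    "('d, 'h) bt_algorithm \<Rightarrow> 'd list \<Rightarrow> ('d list \<times> 'h list) set"
  for A :: "('d, 'h) bt_algorithm" and I :: "'d list" where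
  root: "([], []) \<in> computation_tree A I"
| child: "\<lbrakk> (ds, as) \<in> computation_tree A I; length ds < length I;
      comes_first (item_order A ds as) (set_mset (mset I - mset ds)) d;
      Some a \<in> set (takeWhile (\<lambda>c. c \<noteq> None) (decision_order A ds d as)) \<rbrakk>
    \<Longrightarrow> (ds @ [d], as @ [a]) \<in> computation_tree A I"

definition tree_width :: "('d, 'h) bt_algorithm \<Rightarrow> 'd list \<Rightarrow> nat" where
  "tree_width A I =
     Max ((\<lambda>k. card {v \<in> computation_tree A I. length (fst v) = k}) ` {..length I})"

section \<open>The Simple Knapsack Problem\<close>

definition feasible :: "nat \<Rightarrow> nat list \<Rightarrow> nat set \<Rightarrow> bool" where
  "feasible N xs S \<longleftrightarrow> S \<subseteq> {..<length xs} \<and> (\<Sum>i\<in>S. xs ! i) \<le> N"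

definition optimal :: "nat \<Rightarrow> nat list \<Rightarrow> nat set \<Rightarrow> bool" where
  "optimal N xs S \<longleftrightarrow>
     feasible N xs S \<and> (\<forall>S'. feasible N xs S' \<longrightarrow> (\<Sum>i\<in>S'. xs ! i) \<le> (\<Sum>i\<in>S. xs ! i))"

text \<open>
  The decision \<^const>\<open>True\<close> accepts an item. In a node (ds, as) of depth n, the list ds is a
  rearrangement of the instance, and as is the assignment to its items in that order.
\<close>

definition solves_knapsack :: "nat \<Rightarrow> nat \<Rightarrow> (nat, bool) bt_algorithm \<Rightarrow> bool" where
  "solves_knapsack n N A \<longleftrightarrow>
     (\<forall>xs. length xs = n \<longrightarrow>
        (\<exists>(ds, as) \<in> computation_tree A xs.
           length ds = n \<and> optimal N ds {i. i < n \<and> as ! i}))"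

text \<open>
  An algorithm for the problem with all its input sizes provides ordering and choice functions
  for every number n of items and every capacity N; these may depend on n and N in any way.
\<close>

definition adaptive_bt_solves_knapsack :: "(nat \<Rightarrow> nat \<Rightarrow> (nat, bool) bt_algorithm) \<Rightarrow> bool" where
  "adaptive_bt_solves_knapsack A \<longleftrightarrow>
     (\<forall>n N. N > 0 \<longrightarrow>
        is_bt_algorithm n (A n N) \<and> adaptive n (A n N) \<and> solves_knapsack n N (A n N))"

end

theory Submission
  imports Defs "HOL-Number_Theory.Fib" "HOL-Real_Asymp.Real_Asymp"
begin

text \<open>
  The adversary offers items of size at most w, about N / (m + 1), and lets the algorithm pick
  k of them in its own order, deleting after each pick the finitely many values that would
  create a coincidence of subset sums. For an m-subset Q of the picked items, the remaining
  capacity lies between w and N, hence is a sum of m + 2 further items near its (m + 2)-nd part,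
  and these can be perturbed so that every optimal packing contains exactly Q among the picked
  items. As an adaptive algorithm's first k levels do not depend on the items still to come, all
  these subsets are nodes at depth k of a single tree. With n = k + m + 2 fixed, the binomial
  coefficients "k choose m" sum up to a Fibonacci number, so one of them has exponential order
  at least the golden ratio, whose binary logarithm exceeds 0.694.
\<close>

section \<open>Generic sets of items\<close>

text \<open>A new item equal to some \<open>\<Sum>Y - \<Sum>X\<close> would create two equal subset
  sums; one equal to \<open>N - \<Sum>X\<close> would let a subset fill the capacity. Truncated
  subtraction is harmless: it only yields 0, which is a member anyway via X = Y.\<close>

definition forbidden :: "nat \<Rightarrow> nat set \<Rightarrow> nat set" where
  "forbidden N P = (\<lambda>(X, Y). \<Sum>Y - \<Sum>X) ` (Pow P \<times> Pow P) \<union> (\<lambda>X. N - \<Sum>X) ` Pow P"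

definition generic :: "nat \<Rightarrow> nat set \<Rightarrow> bool" where
  "generic N P \<longleftrightarrow> inj_on \<Sum> (Pow P) \<and> N \<notin> \<Sum> ` Pow P"

lemma forbidden_mono: "P \<subseteq> P' \<Longrightarrow> forbidden N P \<subseteq> forbidden N P'"
  unfolding forbidden_def by (intro Un_mono image_mono Sigma_mono Pow_mono)

lemma subset_forbidden: "P \<subseteq> forbidden N P"
proof
  fix x assume "x \<in> P"
  then have "({}, {x}) \<in> Pow P \<times> Pow P" by simp
  then have "(\<lambda>(X, Y). \<Sum>Y - \<Sum>X) ({}, {x}) \<in> (\<lambda>(X, Y). \<Sum>Y - \<Sum>X) ` (Pow P \<times> Pow P)"
    by (rule imageI)
  then show "x \<in> forbidden N P" by (simp add: forbidden_def)
qed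

lemma finite_forbidden: "finite P \<Longrightarrow> finite (forbidden N P)"
  by (simp add: forbidden_def)

lemma card_forbidden:
  assumes "finite P"
  shows "card (forbidden N P) \<le> 2 * 4 ^ card P"
proof -
  have "card (forbidden N P) \<le> card (Pow P \<times> Pow P) + card (Pow P)"
    unfolding forbidden_def using assms
    by (intro order.trans[OF card_Un_le] add_mono card_image_le) auto
  also have "\<dots> = 4 ^ card P + 2 ^ card P"
    using assms by (simp add: card_cartesian_product card_Pow flip: power_mult_distrib)
  also have "(2::nat) ^ card P \<le> 4 ^ card P"
    by (rule power_mono) auto
  finally show ?thesis by simp
qed

text \<open>If two subsets with equal sums both contain x, cancelling x leads back to P; if only one
  does, x is a difference of subset sums of P, hence forbidden.\<close>

lemma generic_insert:
  assumes "finite P" "generic N P" "x \<notin> forbidden N P"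
  shows "generic N (insert x P)"
proof -
  have diff: "x + \<Sum>X \<noteq> \<Sum>Y" if "X \<subseteq> P" "Y \<subseteq> P" for X Y
  proof
    assume "x + \<Sum>X = \<Sum>Y"
    then have "x = (\<lambda>(X, Y). \<Sum>Y - \<Sum>X) (X, Y)" by simp
    moreover have "(X, Y) \<in> Pow P \<times> Pow P" using that by simp
    ultimately show False using assms(3) unfolding forbidden_def by blast
  qed
  have cap: "x + \<Sum>X \<noteq> N" if "X \<subseteq> P" for X
  proof
    assume "x + \<Sum>X = N"
    then have "x = N - \<Sum>X" by simp
    then show False using assms(3) that unfolding forbidden_def by blast
  qed
  have x: "x \<notin> P" using assms(3) subset_forbidden by blast
  have split: "\<Sum>X = x + \<Sum>(X - {x})" if "X \<subseteq> insert x P" "x \<in> X" for X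
  proof -
    have "finite X" using that assms(1) finite_subset by blast
    then show ?thesis using that by (simp add: sum.remove)
  qed
  have "X = Y" if X: "X \<subseteq> insert x P" and Y: "Y \<subseteq> insert x P" and eq: "\<Sum>X = \<Sum>Y" for X Y
  proof -
    have inj: "X' = Y'" if "X' \<subseteq> P" "Y' \<subseteq> P" "\<Sum>X' = \<Sum>Y'" for X' Y'
      using assms(2) that by (auto simp: generic_def inj_on_def)
    have sub: "X - {x} \<subseteq> P" "Y - {x} \<subseteq> P" using X Y by auto
    consider "x \<in> X" "x \<in> Y" | "x \<in> X" "x \<notin> Y" | "x \<notin> X" "x \<in> Y" | "x \<notin> X" "x \<notin> Y" by blast
    then show ?thesis
    proof cases
      case 1
      then have "X - {x} = Y - {x}" using inj[OF sub] split[OF X] split[OF Y] eq by simp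
      then show ?thesis using 1 by blast
    next
      case 2
      then have "Y \<subseteq> P" using Y by (simp add: subset_insert)
      then show ?thesis using diff[OF sub(1)] split[OF X] 2 eq by metis
    next
      case 3
      then have "X \<subseteq> P" using X by (simp add: subset_insert)
      then show ?thesis using diff[OF sub(2)] split[OF Y] 3 eq by metis
    next
      case 4
      then show ?thesis using inj X Y eq by (simp add: subset_insert)
    qed
  qed
  moreover have "N \<noteq> \<Sum>X" if X: "X \<subseteq> insert x P" for X
  proof (cases "x \<in> X")
    case True
    then show ?thesis using cap[of "X - {x}"] split[OF X] X by auto
  next
    case False
    then have "X \<in> Pow P" using X by auto
    then show ?thesis using assms(2) by (auto simp: generic_def)
  qed
  ultimately show ?thesis unfolding generic_def inj_on_def by blast
qed

section \<open>Multisets whose partial sums avoid a finite set\<close>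

lemma submultisets_add_mset:
  "{M. M \<subseteq># add_mset y A} = {M. M \<subseteq># A} \<union> add_mset y ` {M. M \<subseteq># A}" (is "?L = ?R")
proof
  show "?L \<subseteq> ?R"
  proof
    fix M assume M: "M \<in> ?L"
    show "M \<in> ?R"
    proof (cases "y \<in># M")
      case True
      then obtain M' where "M = add_mset y M'" by (blast dest: multi_member_split)
      then show ?thesis using M by auto
    next
      case False
      then have "M \<subseteq># A" using M by (metis diff_single_trivial mem_Collect_eq subset_eq_diff_conv add_mset_add_single)
      then show ?thesis by simp
    qed
  qed
  show "?R \<subseteq> ?L" by (auto intro: subset_mset.order_trans)
qed

lemma finite_card_submultisets: "finite {M. M \<subseteq># A} \<and> card {M. M \<subseteq># A} \<le> 2 ^ size A"
proof (induction A)
  case empty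
  then show ?case by simp
next
  case (add y A)
  have "card {M. M \<subseteq># add_mset y A} \<le> card {M. M \<subseteq># A} + card {M. M \<subseteq># A}"
    unfolding submultisets_add_mset using add
    by (intro order.trans[OF card_Un_le] add_mono card_image_le) auto
  then show ?case using add by (simp add: submultisets_add_mset)
qed

text \<open>Greedy choice: a new element y must differ from every
  \<open>g - \<Sum>\<^sub># M\<close>, with M among the earlier submultisets. These are at most
  \<open>card G * 2 ^ k\<close> values, fewer than the L candidates. The case of empty M takes care
  of y alone.\<close>

lemma ex_avoiding_submultiset_sums:
  fixes G :: "nat set"
  assumes "finite G" "card G * 2 ^ k < L"
  shows "\<exists>A. size A = k \<and> set_mset A \<subseteq> {b..<b + L} \<and>
           (\<forall>M. M \<subseteq># A \<longrightarrow> M \<noteq> {#} \<longrightarrow> \<Sum>\<^sub># M \<notin> G)"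
  using assms(2)
proof (induction k)
  case 0
  then show ?case by (intro exI[of _ "{#}"]) auto
next
  case (Suc k)
  have GL: "card G * 2 ^ k < L" using Suc.prems by simp
  from Suc.IH[OF this] obtain A where A: "size A = k" "set_mset A \<subseteq> {b..<b + L}"
    "\<And>M. M \<subseteq># A \<Longrightarrow> M \<noteq> {#} \<Longrightarrow> \<Sum>\<^sub># M \<notin> G"
    by blast
  let ?S = "{M. M \<subseteq># A}"
  let ?bad = "(\<lambda>(g, M). g - \<Sum>\<^sub># M) ` (G \<times> ?S)"
  have fin: "finite ?S" and le: "card ?S \<le> 2 ^ k" using finite_card_submultisets[of A] A(1) by auto
  have "card ?bad \<le> card (G \<times> ?S)" using fin assms(1) by (intro card_image_le) auto
  also have "\<dots> \<le> card G * 2 ^ k" using le by (simp add: card_cartesian_product)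
  also have "\<dots> < L" by (rule GL)
  finally have "card ?bad < card {b..<b + L}" by simp
  then have "\<not> {b..<b + L} \<subseteq> ?bad" using fin assms(1) card_mono[of ?bad] by (metis (no_types, lifting) finite_SigmaI finite_imageI linorder_not_less)
  then obtain y where y: "y \<in> {b..<b + L}" "y \<notin> ?bad" by blast
  have "\<Sum>\<^sub># M \<notin> G" if M: "M \<subseteq># add_mset y A" "M \<noteq> {#}" for M
  proof -
    consider "M \<subseteq># A" | M' where "M' \<subseteq># A" "M = add_mset y M'"
      using M(1) submultisets_add_mset[of y A] by auto
    then show ?thesis
    proof cases
      case 1
      then show ?thesis using A(3) M(2) by blast
    next
      case 2
      show ?thesis
      proof
        assume g: "\<Sum>\<^sub># M \<in> G"
        have "y = (\<lambda>(g, M). g - \<Sum>\<^sub># M) (\<Sum>\<^sub># M, M')" using 2 by simp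
        then show False using y(2) g 2(1) by blast
      qed
    qed
  qed
  then show ?case using A y(1) by (intro exI[of _ "add_mset y A"]) auto
qed

text \<open>The last part is determined by the others, so a sum involving it is avoided by letting
  the complementary sum avoid the reflection of the forbidden set in the total.\<close>

lemma ex_generic_parts:
  fixes F :: "nat set"
  assumes "finite F" "r > 0" "2 * card F * 2 ^ r < L" "r * L \<le> s div r" "r \<le> L"
  shows "\<exists>B. size B = r \<and> \<Sum>\<^sub># B = s \<and> (\<forall>x\<in>#B. x \<le> s div r + L) \<and>
           (\<forall>M. M \<subseteq># B \<longrightarrow> M \<noteq> {#} \<longrightarrow> M \<noteq> B \<longrightarrow> \<Sum>\<^sub># M \<notin> F)"
proof -
  define b where "b = s div r"
  define G where "G = F \<union> (\<lambda>f. s - f) ` F"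
  obtain k where r: "r = Suc k" using assms(2) by (cases r) auto
  have G: "finite G" using assms(1) by (simp add: G_def)
  have "card G \<le> card F + card F" unfolding G_def using assms(1)
    by (intro order.trans[OF card_Un_le] add_mono card_image_le) auto
  then have "card G * 2 ^ k \<le> (2 * card F) * 2 ^ r" using r by (intro mult_mono) auto
  then have "card G * 2 ^ k < L" using assms(3) by linarith
  from ex_avoiding_submultiset_sums[OF G this, of b]
  obtain A where A: "size A = k" "set_mset A \<subseteq> {b..<b + L}"
    "\<And>M. M \<subseteq># A \<Longrightarrow> M \<noteq> {#} \<Longrightarrow> \<Sum>\<^sub># M \<notin> G" by blast
  have bounds: "size C * b \<le> \<Sum>\<^sub># C \<and> \<Sum>\<^sub># C \<le> size C * (b + L)"
    if "set_mset C \<subseteq> {b..<b + L}" for C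
    using that by (induction C) auto
  have rb: "r * b \<le> s" "s < r * b + r"
    using dividend_less_times_div[OF assms(2), of s] by (simp_all add: b_def add.commute)
  \<comment> \<open>Each of the k chosen parts exceeds b by less than L, so together they exceed k *
    b by at most b. Hence their sum is at most r * b \<le> s, and the subtraction defining the last
    part z is not truncated.\<close>
  have "k * L \<le> b" using assms(4) r b_def by simp
  then have le: "\<Sum>\<^sub># A \<le> s" using bounds[OF A(2)] A(1) rb(1) r
    by (simp add: algebra_simps)
  define z where "z = s - \<Sum>\<^sub># A"
  have "k * b \<le> \<Sum>\<^sub># A" using bounds[OF A(2)] A(1) by simp
  then have "z \<le> b + r" using rb(2) r by (simp add: z_def)
  then have z: "z \<le> b + L" using assms(5) by simp
  have "\<Sum>\<^sub># M \<notin> F" if M: "M \<subseteq># add_mset z A" "M \<noteq> {#}" "M \<noteq> add_mset z A" for M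
  proof -
    consider "M \<subseteq># A" | M' where "M' \<subseteq># A" "M = add_mset z M'"
      using M(1) submultisets_add_mset[of z A] by auto
    then show ?thesis
    proof cases
      case 1
      then show ?thesis using A(3) M(2) by (auto simp: G_def)
    next
      case 2
      define C where "C = A - M'"
      have AC: "A = M' + C" using 2(1) by (simp add: C_def)
      have "C \<noteq> {#}" using AC 2(2) M(3) by auto
      then have "\<Sum>\<^sub># C \<notin> G" using A(3) by (simp add: AC)
      moreover have "\<Sum>\<^sub># C = s - \<Sum>\<^sub># M" using le 2(2) by (simp add: z_def AC)
      ultimately show ?thesis by (auto simp: G_def)
    qed
  qed
  moreover have "\<Sum>\<^sub># (add_mset z A) = s" using le by (simp add: z_def)
  moreover have "\<forall>x\<in>#add_mset z A. x \<le> b + L" using A(2) z by auto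
  ultimately show ?thesis using A(1) r unfolding b_def
    by (intro exI[of _ "add_mset z A"]) auto
qed

section \<open>The adversary\<close>

text \<open>The order depends on the items alone, which is what adaptivity provides. The cutoff w
  keeps the candidate set finite, since an arbitrary linear order of the naturals may have no first
  element.\<close>

definition adversary_items :: "(nat list \<Rightarrow> nat rel) \<Rightarrow> nat \<Rightarrow> nat \<Rightarrow> nat list \<Rightarrow> bool" where
  "adversary_items ord N w ds \<longleftrightarrow>
     (\<forall>i<length ds. comes_first (ord (take i ds)) ({..w} - forbidden N (set (take i ds))) (ds ! i))"

lemma linear_order_ex_first:
  assumes "linear_order r" "finite S" "S \<noteq> {}"
  shows "\<exists>d. comes_first r S d"
  using assms(2,3)
proof (induction S rule: finite_ne_induct)
  case (singleton x)
  then show ?case using assms(1)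
    by (auto simp: comes_first_def order_on_defs refl_on_def)
next
  case (insert x F)
  then obtain d where d: "comes_first r F d" by blast
  have tr: "trans r" and tot: "total r" and rf: "refl r"
    using assms(1) by (auto simp: order_on_defs)
  show ?case
  proof (cases "(d, x) \<in> r")
    case True
    then show ?thesis using d by (auto simp: comes_first_def)
  next
    case False
    then have "(x, d) \<in> r" using tot rf by (metis UNIV_I refl_onD total_on_def)
    then have "comes_first r (insert x F) x"
      using d rf tr by (auto simp: comes_first_def refl_onD dest: transD)
    then show ?thesis by blast
  qed
qed

lemma comes_first_unique:
  "linear_order r \<Longrightarrow> comes_first r S d \<Longrightarrow> comes_first r S e \<Longrightarrow> d = e"
  by (auto simp: comes_first_def order_on_defs antisym_def)

lemma comes_first_subset:
  "comes_first r S d \<Longrightarrow> S' \<subseteq> S \<Longrightarrow> d \<in> S' \<Longrightarrow> comes_first r S' d"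
  by (auto simp: comes_first_def)

text \<open>At each step at most \<open>2 * 4 ^ k\<close> values are forbidden, fewer than the w + 1
  elements of \<open>{..w}\<close>, so a nonempty finite candidate set remains and has a first
  element.\<close>

lemma ex_adversary_items:
  assumes "\<And>ds. length ds < k \<Longrightarrow> linear_order (ord ds)" "2 * 4 ^ k \<le> w"
  shows "\<exists>ds. length ds = k \<and> adversary_items ord N w ds"
  using assms
proof (induction k)
  case 0
  then show ?case by (auto simp: adversary_items_def)
next
  case (Suc k)
  then obtain ds where ds: "length ds = k" "adversary_items ord N w ds" by auto
  let ?F = "forbidden N (set ds)"
  have "card ?F \<le> 2 * 4 ^ card (set ds)" by (intro card_forbidden) simp
  also have "\<dots> \<le> 2 * 4 ^ k" using ds(1) card_length[of ds] by (intro mult_left_mono power_increasing) auto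
  also have "\<dots> < card {..w}" using Suc.prems(2) by simp
  finally have "\<not> {..w} \<subseteq> ?F"
    using card_mono[OF finite_forbidden[of "set ds" N]] by (metis List.finite_set linorder_not_less)
  then have "{..w} - ?F \<noteq> {}" by blast
  then obtain d where "comes_first (ord ds) ({..w} - ?F) d"
    using linear_order_ex_first[of "ord ds" "{..w} - ?F"] Suc.prems(1) ds(1) by auto
  then show ?case using ds
    by (intro exI[of _ "ds @ [d]"]) (auto simp: adversary_items_def nth_append less_Suc_eq)
qed

lemma adversary_items_generic:
  assumes "adversary_items ord N w ds" "N > 0"
  shows "generic N (set ds) \<and> distinct ds \<and> set ds \<subseteq> {..w}"
  using assms(1)
proof (induction ds rule: rev_induct)
  case Nil
  \<comment> \<open>Positivity of N matters here: the empty sum must not fill the capacity.\<close>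
  then show ?case using assms(2) by (simp add: generic_def)
next
  case (snoc d ds)
  have "adversary_items ord N w ds"
    unfolding adversary_items_def
  proof (intro allI impI)
    fix i assume "i < length ds"
    then show "comes_first (ord (take i ds)) ({..w} - forbidden N (set (take i ds))) (ds ! i)"
      using snoc.prems[unfolded adversary_items_def, rule_format, of i] by (simp add: nth_append)
  qed
  then have IH: "generic N (set ds)" "distinct ds" "set ds \<subseteq> {..w}" using snoc.IH by auto
  have d: "d \<le> w" "d \<notin> forbidden N (set ds)"
    using snoc.prems[unfolded adversary_items_def, rule_format, of "length ds"]
    by (auto simp: comes_first_def)
  then have "d \<notin> set ds" using subset_forbidden by blast
  then show ?case using IH d generic_insert[OF _ IH(1) d(2)] by auto
qed

text \<open>Forbidden sets grow with the prefix, so all items still unseen after i steps were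
  already candidates when \<open>ds ! i\<close> was picked as the first of the candidates. It stays
  first in the smaller set.\<close>

lemma adversary_items_first:
  assumes "adversary_items ord N w ds" "i < length ds" "set R \<subseteq> {..w} - forbidden N (set ds)"
  shows "comes_first (ord (take i ds)) (set_mset (mset (ds @ R) - mset (take i ds))) (ds ! i)"
proof -
  have "mset (ds @ R) = mset (take i ds) + mset (drop i ds @ R)"
    by (metis append_assoc append_take_drop_id mset_append)
  then have eq: "set_mset (mset (ds @ R) - mset (take i ds)) = set (drop i ds) \<union> set R" by simp
  have "set (drop i ds) \<subseteq> {..w} - forbidden N (set (take i ds))"
  proof
    fix x assume "x \<in> set (drop i ds)"
    then obtain j where j: "i \<le> j" "j < length ds" "x = ds ! j"
      by (auto simp: in_set_conv_nth) (metis add.commute le_add1 less_diff_conv)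
    then have "x \<in> {..w} - forbidden N (set (take j ds))"
      using assms(1) by (auto simp: adversary_items_def comes_first_def)
    then show "x \<in> {..w} - forbidden N (set (take i ds))"
      using forbidden_mono[OF set_take_subset_set_take[OF j(1)]] by blast
  qed
  moreover have "set R \<subseteq> {..w} - forbidden N (set (take i ds))"
    using assms(3) forbidden_mono[OF set_take_subset] by blast
  moreover have "ds ! i \<in> set (drop i ds)" using assms(2)
    by (metis Cons_nth_drop_Suc list.set_intros(1))
  moreover have "comes_first (ord (take i ds)) ({..w} - forbidden N (set (take i ds))) (ds ! i)"
    using assms(1,2) by (simp add: adversary_items_def)
  ultimately show ?thesis unfolding eq by (meson UnI1 Un_least comes_first_subset)
qed

section \<open>The computation tree\<close>

lemma computation_tree_length:
  "(es, as) \<in> computation_tree A xs \<Longrightarrow> length as = length es"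
  by (induction rule: computation_tree.induct) auto

lemma computation_tree_submset:
  "(es, as) \<in> computation_tree A xs \<Longrightarrow> mset es \<subseteq># mset xs"
proof (induction rule: computation_tree.induct)
  case (child ds as d a)
  then have "d \<in># mset xs - mset ds" by (simp add: comes_first_def)
  then have "{#d#} \<subseteq># mset xs - mset ds" by simp
  then show ?case using child.IH
    by (metis add.commute mset.simps(1) mset.simps(2) mset_append subset_mset.le_diff_conv2)
qed simp

lemma computation_tree_take:
  "(es, as) \<in> computation_tree A xs \<Longrightarrow> (take k es, take k as) \<in> computation_tree A xs"
proof (induction rule: computation_tree.induct)
  case root
  then show ?case by (simp add: computation_tree.root)
next
  case (child ds as d a)
  have "length as = length ds" using child.hyps(1) by (rule computation_tree_length)
  then show ?case using child.IH computation_tree.child[OF child.hyps]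
    by (cases "k \<le> length ds") auto
qed

text \<open>Until the adversary's items are exhausted, the algorithm cannot tell apart the instances
  that extend them by items that are not forbidden.\<close>

lemma computation_tree_prefix:
  fixes A :: "(nat, bool) bt_algorithm"
  assumes "is_bt_algorithm n A" "adaptive n A" "length ds \<le> n"
    and "adversary_items (\<lambda>es. item_order A es (replicate (length es) True)) N w ds"
    and R: "set R \<subseteq> {..w} - forbidden N (set ds)"
    and R': "set R' \<subseteq> {..w} - forbidden N (set ds)"
    and "(es, as) \<in> computation_tree A (ds @ R)" "length es \<le> length ds"
  shows "es = take (length es) ds \<and> (es, as) \<in> computation_tree A (ds @ R')"
  using assms(7,8)
proof (induction rule: computation_tree.induct)
  case root
  then show ?case by (simp add: computation_tree.root)
next
  case (child es as e a)
  let ?i = "length es"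
  have i: "?i < length ds" using child.prems by simp
  have es: "es = take ?i ds" and mem: "(es, as) \<in> computation_tree A (ds @ R')"
    using child.IH i by auto
  have len: "length as = ?i" using child.hyps(1) by (rule computation_tree_length)
  \<comment> \<open>The all-True list is a dummy decision vector; adaptivity makes it
    interchangeable with the actual decisions.\<close>
  have ord: "item_order A es as = item_order A es (replicate ?i True)"
    by (rule assms(2)[unfolded adaptive_def, rule_format]) (use assms(3) i len in auto)
  have lin: "linear_order (item_order A es as)"
    using assms(1,3) i len by (auto simp: is_bt_algorithm_def)
  have "length (take ?i ds) = ?i" using i by simp
  \<comment> \<open>Stated for any admissible completion X: with R it identifies the item seen, with
    R' it replays the step in the other tree.\<close>
  then have first: "comes_first (item_order A es as) (set_mset (mset (ds @ X) - mset es)) (ds ! ?i)"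
    if "set X \<subseteq> {..w} - forbidden N (set ds)" for X
    using adversary_items_first[OF assms(4) i that] ord es by simp
  have e: "e = ds ! ?i"
    using comes_first_unique[OF lin child.hyps(3) first[OF R]] .
  have "(es @ [e], as @ [a]) \<in> computation_tree A (ds @ R')"
    using i child.hyps(4) first[OF R'] by (intro computation_tree.child mem) (auto simp: e)
  moreover have "es @ [e] = take (Suc ?i) ds" using es e i by (metis take_Suc_conv_app_nth)
  ultimately show ?case by (metis length_append_singleton)
qed

section \<open>Forced subsets and the width of the tree\<close>

lemma card_le_tree_width:
  "k \<le> length xs \<Longrightarrow> card {v \<in> computation_tree A xs. length (fst v) = k} \<le> tree_width A xs"
  unfolding tree_width_def by (intro Max_ge) auto

text \<open>If the parts outside the generic set fill the capacity together with a subset of it, and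
  if no other subcollection of the parts leaves room for a subset, that subset is forced.\<close>

lemma optimal_forces_subset:
  assumes "distinct ds" "generic N (set ds)" "Q \<subseteq> set ds"
    and "\<Sum>\<^sub># (mset R) + \<Sum>Q = N"
    and avoid: "\<And>M. M \<subseteq># mset R \<Longrightarrow> M \<noteq> {#} \<Longrightarrow> M \<noteq> mset R \<Longrightarrow> \<Sum>\<^sub># M \<notin> forbidden N (set ds)"
    and "optimal N (ds @ R) S"
  shows "\<forall>i<length ds. i \<in> S \<longleftrightarrow> ds ! i \<in> Q"
proof -
  let ?k = "length ds" and ?n = "length (ds @ R)"
  let ?x = "\<lambda>i. (ds @ R) ! i"
  have "image_mset ?x (mset_set {?k..<?n}) = mset (map ?x [?k..<?n])" by simp
  also have "map ?x [?k..<?n] = R" by (intro nth_equalityI) auto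
  finally have R: "image_mset ?x (mset_set {?k..<?n}) = mset R" .
  \<comment> \<open>An index set splits into a genuine subset of the distinct list \<open>ds\<close>
    and a submultiset of R, where values may repeat.\<close>
  have split: "\<exists>X M. X = (!) ds ` (T \<inter> {..<?k}) \<and> X \<subseteq> set ds \<and> M = image_mset ?x (mset_set (T - {..<?k}))
      \<and> M \<subseteq># mset R \<and> (\<Sum>i\<in>T. ?x i) = \<Sum>X + \<Sum>\<^sub># M" if T: "T \<subseteq> {..<?n}" for T
  proof -
    let ?X = "(!) ds ` (T \<inter> {..<?k})" and ?M = "image_mset ?x (mset_set (T - {..<?k}))"
    have fin: "finite T" using T finite_subset by blast
    have "mset_set (T - {..<?k}) \<subseteq># mset_set {?k..<?n}"
      using T by (intro subset_imp_msubset_mset_set) auto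
    then have "?M \<subseteq># mset R" unfolding R[symmetric] by (rule image_mset_subseteq_mono)
    moreover have "inj_on ((!) ds) (T \<inter> {..<?k})"
      using assms(1) by (auto simp: inj_on_def nth_eq_iff_index_eq)
    then have "\<Sum>?X = (\<Sum>i\<in>T \<inter> {..<?k}. ?x i)"
      by (simp add: sum.reindex nth_append)
    moreover have "(\<Sum>i\<in>T. ?x i) = (\<Sum>i\<in>T \<inter> {..<?k}. ?x i) + (\<Sum>i\<in>T - {..<?k}. ?x i)"
      using fin by (rule sum.Int_Diff)
    moreover have "\<Sum>\<^sub># ?M = (\<Sum>i\<in>T - {..<?k}. ?x i)" by (simp add: sum_unfold_sum_mset)
    moreover have "?X \<subseteq> set ds" by auto
    ultimately show ?thesis by auto
  qed
  \<comment> \<open>T packs Q together with all parts and fills the capacity exactly, so every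
    optimal packing has value N.\<close>
  define T where "T = {i. i < ?k \<and> ds ! i \<in> Q} \<union> {?k..<?n}"
  have T: "T \<subseteq> {..<?n}" by (auto simp: T_def)
  have "(!) ds ` (T \<inter> {..<?k}) = Q" using assms(3)
  proof (intro equalityI subsetI)
    fix x assume "x \<in> Q"
    then obtain i where "i < ?k" "ds ! i = x" using assms(3) by (metis in_set_conv_nth subsetD)
    then show "x \<in> (!) ds ` (T \<inter> {..<?k})" using \<open>x \<in> Q\<close> by (intro image_eqI[of _ _ i]) (auto simp: T_def)
  qed (auto simp: T_def)
  moreover have "T - {..<?k} = {?k..<?n}" by (auto simp: T_def)
  ultimately have "(\<Sum>i\<in>T. ?x i) = N" using split[OF T] assms(4) R by auto
  then have "feasible N (ds @ R) T" and "N \<le> (\<Sum>i\<in>S. ?x i)"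
    using assms(6) T by (auto simp: feasible_def optimal_def)
  moreover have "(\<Sum>i\<in>S. ?x i) \<le> N" and S: "S \<subseteq> {..<?n}"
    using assms(6) by (auto simp: feasible_def optimal_def)
  ultimately have SN: "(\<Sum>i\<in>S. ?x i) = N" by simp
  obtain X M where X: "X = (!) ds ` (S \<inter> {..<?k})" "X \<subseteq> set ds"
    and M: "M \<subseteq># mset R" "(\<Sum>i\<in>S. ?x i) = \<Sum>X + \<Sum>\<^sub># M" using split[OF S] by blast
  \<comment> \<open>Genericity rules out reaching N without parts. Otherwise the sum of M has the
    forbidden form \<open>N - \<Sum>X\<close>, which only the full collection of parts may take;
    then X and Q have equal sums and coincide.\<close>
  have "M \<noteq> {#}" using assms(2) X M SN by (auto simp: generic_def)
  moreover have "\<Sum>\<^sub># M = N - \<Sum>X" using M(2) SN by simp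
  then have "\<Sum>\<^sub># M \<in> forbidden N (set ds)" using X(2) unfolding forbidden_def by blast
  ultimately have "M = mset R" using avoid[OF M(1)] by blast
  then have "\<Sum>X = \<Sum>Q" using M(2) SN assms(4) by simp
  then have XQ: "X = Q" using assms(2,3) X(2) by (auto simp: generic_def inj_on_def)
  show ?thesis
  proof (intro allI impI iffI)
    fix i assume "i < ?k" "i \<in> S"
    then show "ds ! i \<in> Q" using XQ X(1) by auto
  next
    fix i assume i: "i < ?k" "ds ! i \<in> Q"
    then obtain j where "j \<in> S" "j < ?k" "ds ! i = ds ! j" using XQ X(1) by auto
    then show "i \<in> S" using i assms(1) by (simp add: nth_eq_iff_index_eq)
  qed
qed

text \<open>On the instance completed by the parts B made for Q, an optimal leaf must decide Q on
  \<open>ds\<close>. Its ancestor at depth \<open>length ds\<close> is unaffected by the completion,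
  so it also occurs in the tree for any other admissible R'.\<close>

lemma subset_node:
  fixes A :: "(nat, bool) bt_algorithm"
  assumes A: "is_bt_algorithm n A" "adaptive n A" "solves_knapsack n N A" "N > 0"
    and adv: "adversary_items (\<lambda>es. item_order A es (replicate (length es) True)) N w ds"
    and "Q \<subseteq> set ds" "n = length ds + size B" "\<Sum>\<^sub># B + \<Sum>Q = N"
    and B: "set_mset B \<subseteq> {..w} - forbidden N (set ds)"
    and avoid: "\<And>M. M \<subseteq># B \<Longrightarrow> M \<noteq> {#} \<Longrightarrow> M \<noteq> B \<Longrightarrow> \<Sum>\<^sub># M \<notin> forbidden N (set ds)"
    and R': "set R' \<subseteq> {..w} - forbidden N (set ds)"
  shows "(ds, map (\<lambda>d. d \<in> Q) ds) \<in> computation_tree A (ds @ R')"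
proof -
  let ?k = "length ds"
  have gen: "generic N (set ds)" and dis: "distinct ds" using adversary_items_generic[OF adv A(4)] by auto
  obtain R where R: "mset R = B" by (metis ex_mset)
  have Rset: "set R \<subseteq> {..w} - forbidden N (set ds)" using B R by auto
  have kn: "?k \<le> n" using assms(7) by simp
  have "length (ds @ R) = n" using assms(7) R by auto
  then obtain es as where node: "(es, as) \<in> computation_tree A (ds @ R)" "length es = n"
    and opt: "optimal N es {i. i < n \<and> as ! i}"
    using A(3) unfolding solves_knapsack_def by blast
  have tk: "(take ?k es, take ?k as) \<in> computation_tree A (ds @ R)"
    using node(1) by (rule computation_tree_take)
  have "length (take ?k es) = ?k" using node(2) kn by simp
  then have pre: "take ?k es = ds" "(take ?k es, take ?k as) \<in> computation_tree A (ds @ R')"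
    using computation_tree_prefix[OF A(1,2) kn adv Rset R' tk] by auto
  \<comment> \<open>Optimality refers to the order in which the leaf lists the items, so the tail of
    \<open>es\<close> is first shown to be a rearrangement of B.\<close>
  define R1 where "R1 = drop ?k es"
  have es: "es = ds @ R1" using pre by (metis R1_def append_take_drop_id)
  have "mset es \<subseteq># mset (ds @ R)" using node(1) by (rule computation_tree_submset)
  then have "mset R1 \<subseteq># B" using R by (simp add: es)
  moreover have "size (mset R1) = size B" using node(2) assms(7) by (simp add: es)
  ultimately have R1: "mset R1 = B" by (metis mset_subset_size nless_le subset_mset.nless_le)
  have forced: "\<forall>i<?k. i \<in> {i. i < n \<and> as ! i} \<longleftrightarrow> ds ! i \<in> Q"
    by (rule optimal_forces_subset[OF dis gen assms(6), of R1]) (use R1 avoid opt es assms(8) in auto)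
  have "length as = n" using computation_tree_length[OF node(1)] node(2) by simp
  then have "take ?k as = map (\<lambda>d. d \<in> Q) ds"
    using forced kn by (intro nth_equalityI) auto
  then show ?thesis using pre by simp
qed

lemma binomial_le_tree_width:
  fixes A :: "(nat, bool) bt_algorithm"
  assumes A: "is_bt_algorithm n A" "adaptive n A" "solves_knapsack n N A"
    and n: "n = k + m + 2" and "m \<le> k" and N: "N \<ge> 5 * 4 ^ n * n ^ 3"
  shows "\<exists>xs. length xs = n \<and> k choose m \<le> tree_width A xs"
proof -
  \<comment> \<open>An m-subset weighs at most m * w, leaving a remainder s \<ge> w to be cut into r
    parts. L exceeds \<open>4 * 4 ^ k * 4 ^ r\<close>, which bounds the number of values the parts
    must avoid. The cubic factor in N gives \<open>r * r * L \<le> w\<close>, room for perturbations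
    of size L.\<close>
  define w where "w = N div (m + 1)"
  define L :: nat where "L = 5 * 4 ^ n"
  define r where "r = m + 2"
  let ?ord = "\<lambda>es. item_order A es (replicate (length es) True)"
  have N0: "N > 0"
  proof -
    have "0 < 5 * 4 ^ n * n ^ 3" using n by simp
    then show ?thesis using N by linarith
  qed
  have rn: "r \<le> n" "m + 1 \<le> n" using n by (auto simp: r_def)
  have "(m + 1) * (r * r * L) \<le> n * (n * n * L)" using rn by (intro mult_mono) auto
  also have "\<dots> \<le> N" using N by (simp add: L_def power3_eq_cube mult_ac)
  finally have w: "r * r * L \<le> w" unfolding w_def
    by (subst less_eq_div_iff_mult_less_eq) (auto simp: mult_ac)
  have rLw: "r * L \<le> w"
    by (rule order.trans[OF _ w]) (intro mult_right_mono, auto simp: r_def)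
  have "L \<le> r * L" by (simp add: r_def)
  then have Lw: "L \<le> w" using rLw by linarith
  have nL: "n \<le> L"
  proof -
    have "n < 2 ^ n" by (rule less_exp)
    also have "(2::nat) ^ n \<le> 4 ^ n" by (rule power_mono) auto
    finally show ?thesis by (simp add: L_def)
  qed
  have wN: "(m + 1) * w \<le> N" "N < (m + 1) * w + (m + 1)"
    using times_div_less_eq_dividend[of "m + 1" N] dividend_less_times_div[of "m + 1" N]
    by (simp_all only: w_def add.commute)
  have "(4::nat) ^ k \<le> 4 ^ n" using n by (intro power_increasing) auto
  then have kw: "2 * 4 ^ k \<le> w" using Lw unfolding L_def by linarith
  have "linear_order (?ord es)" if "length es < k" for es
    using A(1) that n by (simp add: is_bt_algorithm_def)
  then obtain ds where ds: "length ds = k" and adv: "adversary_items ?ord N w ds"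
    using ex_adversary_items[of k ?ord w N] kw by blast
  have dis: "distinct ds" and dsw: "set ds \<subseteq> {..w}" using adversary_items_generic[OF adv N0] by auto
  let ?F = "forbidden N (set ds)"
  have parts: "\<exists>B. size B = r \<and> \<Sum>\<^sub># B + \<Sum>Q = N \<and> set_mset B \<subseteq> {..w} - ?F \<and>
      (\<forall>M. M \<subseteq># B \<longrightarrow> M \<noteq> {#} \<longrightarrow> M \<noteq> B \<longrightarrow> \<Sum>\<^sub># M \<notin> ?F)"
    if Q: "Q \<subseteq> set ds" "card Q = m" for Q
  proof -
    define s where "s = N - \<Sum>Q"
    have "\<Sum>Q \<le> m * w" using sum_bounded_above[of Q "\<lambda>x. x" w] Q dsw by auto
    then have Qs: "\<Sum>Q \<le> N" "w \<le> s" using wN(1) by (auto simp: s_def)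
    have "card ?F \<le> 2 * 4 ^ k" using card_forbidden[of "set ds" N] ds dis by (simp add: distinct_card)
    then have "2 * card ?F \<le> 4 * 4 ^ k" by linarith
    moreover have "(2::nat) ^ r \<le> 4 ^ r" by (rule power_mono) auto
    ultimately have "2 * card ?F * 2 ^ r \<le> (4 * 4 ^ k) * 4 ^ r" by (rule mult_le_mono)
    also have "\<dots> < L" using n by (simp add: L_def r_def power_add)
    finally have c1: "2 * card ?F * 2 ^ r < L" .
    have "r > 0" by (simp add: r_def)
    then have "r * L = r * r * L div r" by (simp add: mult.assoc)
    also have "\<dots> \<le> s div r" using w Qs(2) by (intro div_le_mono) linarith
    finally have c2: "r * L \<le> s div r" .
    obtain B where B: "size B = r" "\<Sum>\<^sub># B = s" "\<forall>x\<in>#B. x \<le> s div r + L"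
      "\<And>M. M \<subseteq># B \<Longrightarrow> M \<noteq> {#} \<Longrightarrow> M \<noteq> B \<Longrightarrow> \<Sum>\<^sub># M \<notin> ?F"
      using ex_generic_parts[OF finite_forbidden[OF List.finite_set] \<open>r > 0\<close> c1 c2] rn(1) nL
      by (metis order.trans)
    \<comment> \<open>Since s \<le> N < (r - 1) * (w + 1), the average part lies about w / r below
      w, and w / r \<ge> L. This is why one part more than m + 1 is taken.\<close>
    have "s div r + L \<le> w"
    proof -
      have "r * (s div r) \<le> s" by simp
      also have "\<dots> \<le> N" by (simp add: s_def)
      also have "\<dots> < r * w - w + r" using wN(2) by (simp add: r_def)
      finally have "r * (s div r) + w < r * w + r" by (simp add: r_def)
      then have "r * (s div r + L) < r * (w + 1)" using rLw by (simp add: algebra_simps)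
      then have "s div r + L < w + 1" by (simp only: mult_less_cancel1)
      then show ?thesis by simp
    qed
    moreover have "x \<notin> ?F" if "x \<in># B" for x
    proof -
      \<comment> \<open>As r \<ge> 2, singletons are proper submultisets, so avoidance of their sums
        makes each part itself admissible.\<close>
      have "{#x#} \<noteq> B" using B(1) by (auto simp: r_def)
      then show ?thesis using B(4)[of "{#x#}"] that by auto
    qed
    ultimately show ?thesis using B Qs(1) by (intro exI[of _ B]) (fastforce simp: s_def)
  qed
  \<comment> \<open>The parts of one arbitrary m-subset fix the final instance; the nodes of all
    other m-subsets are transported to it.\<close>
  have "\<exists>Q\<subseteq>set ds. card Q = m" using assms(5) ds dis
    by (metis obtain_subset_with_card_n distinct_card)
  then obtain R where R: "length R = r" "set R \<subseteq> {..w} - ?F"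
    using parts by (metis ex_mset set_mset_mset size_mset)
  let ?xs = "ds @ R" and ?f = "\<lambda>Q. (ds, map (\<lambda>d. d \<in> Q) ds)"
  let ?QQ = "{Q. Q \<subseteq> set ds \<and> card Q = m}"
  let ?V = "{v \<in> computation_tree A ?xs. length (fst v) = k}"
  have "?f Q \<in> ?V" if Q: "Q \<in> ?QQ" for Q
  proof -
    obtain B where B: "size B = r" "\<Sum>\<^sub># B + \<Sum>Q = N" "set_mset B \<subseteq> {..w} - ?F"
      "\<And>M. M \<subseteq># B \<Longrightarrow> M \<noteq> {#} \<Longrightarrow> M \<noteq> B \<Longrightarrow> \<Sum>\<^sub># M \<notin> ?F"
      using parts Q by blast
    have "n = length ds + size B" using n ds B(1) by (simp add: r_def)
    then show ?thesis using subset_node[OF A N0 adv _ _ B(2,3,4) R(2)] Q ds by auto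
  qed
  then have sub: "?f ` ?QQ \<subseteq> ?V" by blast
  have inj: "inj_on ?f ?QQ" by (auto simp: inj_on_def)
  \<comment> \<open>All nodes at depth k list the same items, so the level is finite and its
    \<open>card\<close> is meaningful.\<close>
  have "?V \<subseteq> {ds} \<times> {as. set as \<subseteq> UNIV \<and> length as = k}"
  proof
    fix v assume v: "v \<in> ?V"
    obtain es as where "v = (es, as)" by (cases v)
    then show "v \<in> {ds} \<times> {as. set as \<subseteq> UNIV \<and> length as = k}"
      using v computation_tree_length[of es as A ?xs] ds n
        computation_tree_prefix[OF A(1,2) _ adv R(2) R(2), of es as] by auto
  qed
  moreover have "finite ({ds} \<times> {as. set as \<subseteq> (UNIV :: bool set) \<and> length as = k})"
    by (intro finite_cartesian_product finite_lists_length_eq) auto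
  ultimately have "finite ?V" by (rule finite_subset)
  then have "card ?QQ \<le> card ?V" using card_inj_on_le[OF inj sub] by blast
  also have "card ?QQ = k choose m" using ds dis by (simp add: n_subsets distinct_card)
  finally have "k choose m \<le> card ?V" .
  also have "\<dots> \<le> tree_width A ?xs" using ds by (intro card_le_tree_width) simp
  finally show ?thesis using ds R(1) n by (intro exI[of _ ?xs]) (simp add: r_def)
qed

section \<open>The golden ratio\<close>

text \<open>1.618 lies just below the golden ratio, so its square is at most 1.618 + 1 and the
  Fibonacci recurrence dominates.\<close>

lemma fib_ge_power: "(1.618::real) ^ n \<le> real (fib (n + 2))"
proof (induction n rule: fib.induct)
  case (3 n)
  have "(1.618::real) ^ Suc (Suc n) = 1.618 ^ 2 * 1.618 ^ n" by (simp add: power2_eq_square)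
  also have "\<dots> \<le> (1.618 + 1) * 1.618 ^ n" by (intro mult_right_mono) (auto simp: power2_eq_square)
  also have "\<dots> = 1.618 ^ Suc n + 1.618 ^ n" by (simp add: algebra_simps)
  also have "\<dots> \<le> real (fib (Suc n + 2)) + real (fib (n + 2))" using 3 by (intro add_mono)
  finally show ?case by simp
qed (auto simp: numeral_eq_Suc)

text \<open>The fraction 59/85 lies between 0.694 and the binary logarithm of 1.618, which reduces
  the claim to comparing 2^59 with 1.618^85.\<close>

lemma two_powr_le: "2 powr 0.694 \<le> (1.618::real)"
proof -
  have "(2 powr (59 / 85)) ^ 85 = (2::real) powr 59" by (simp add: powr_power)
  also have "\<dots> = 2 ^ 59" by (rule powr_numeral) simp
  also have "\<dots> \<le> (1.618::real) ^ 85" by (simp add: power_divide)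
  finally have "2 powr (59 / 85) \<le> (1.618::real)"
    by (rule power_le_imp_le_base[of _ 84, simplified]) simp
  moreover have "2 powr 0.694 \<le> (2::real) powr (59 / 85)" by (intro powr_mono) auto
  ultimately show ?thesis by linarith
qed

text \<open>A shallow diagonal of Pascal's triangle has k + 1 terms with sum
  \<open>fib (k + 1)\<close>, so some term is at least the average.\<close>

lemma ex_binomial_ge:
  "\<exists>m\<le>k. fib (k + 1) \<le> (k + 1) * ((k - m) choose m)"
proof (rule ccontr)
  assume "\<not> ?thesis"
  then have *: "\<And>m. m \<le> k \<Longrightarrow> (k + 1) * ((k - m) choose m) < fib (k + 1)" by force
  have "(k + 1) * fib (k + 1) = (\<Sum>m = 0..k. (k + 1) * ((k - m) choose m))"
    unfolding sum_distrib_left[symmetric] using ne_diagonal_fib[of k] by simp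
  also have "\<dots> < (\<Sum>m = 0..k. fib (k + 1))" by (intro sum_strict_mono) (use * in auto)
  finally show False by simp
qed

text \<open>The constants c and n0 are uniform in the algorithm, and the bound holds for every
  capacity from some N0 on.\<close>

theorem theorem2:
  fixes \<epsilon> :: real
  assumes "\<epsilon> > 0"
  shows "\<exists>c>0. \<exists>n0. \<forall>A. adaptive_bt_solves_knapsack A \<longrightarrow>
    (\<forall>n\<ge>n0. \<exists>N0>0. \<forall>N\<ge>N0. \<exists>xs. length xs = n \<and>
       real (tree_width (A n N) xs) \<ge> c * (2 powr ((0.694 - \<epsilon>) * real n) / sqrt (real n)))"
proof -
  \<comment> \<open>Pays for the index shift: \<open>fib (n - 1)\<close> is bounded below by the
    power n - 3 only.\<close>
  define c :: real where "c = 1 / 1.618 ^ 3"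
  \<comment> \<open>The factor n lost by averaging over the binomial coefficients is absorbed by
    \<epsilon>.\<close>
  have "\<forall>\<^sub>F n in sequentially. real n \<le> 2 powr (\<epsilon> * real n)"
    using assms by real_asymp
  then obtain n1 where n1: "\<And>n. n \<ge> n1 \<Longrightarrow> real n \<le> 2 powr (\<epsilon> * real n)"
    by (auto simp: eventually_sequentially)
  have "\<exists>N0>0. \<forall>N\<ge>N0. \<exists>xs. length xs = n \<and>
       real (tree_width (A n N) xs) \<ge> c * (2 powr ((0.694 - \<epsilon>) * real n) / sqrt (real n))"
    if A: "adaptive_bt_solves_knapsack A" and n: "n \<ge> max n1 3" for A n
  proof -
    obtain m where m: "m \<le> n - 2" "fib (n - 1) \<le> (n - 1) * ((n - 2 - m) choose m)"
      using ex_binomial_ge[of "n - 2"] n by (auto simp: Suc_diff_Suc numeral_eq_Suc)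
    define k where "k = n - 2 - m"
    have nk: "n = k + m + 2" using m(1) n unfolding k_def by linarith
    have fib: "1.618 ^ (n - 3) \<le> real (fib (n - 1))"
      using fib_ge_power[of "n - 3"] n by (simp add: numeral_eq_Suc Suc_diff_Suc)
    \<comment> \<open>A positive Fibonacci number forces a nonzero coefficient, hence m \<le>
      k.\<close>
    have "0 < fib (n - 1)" using n by (intro fib_neq_0_nat) simp
    then have "0 < k choose m" using m(2) by (metis k_def mult_is_0 not_gr0 le_zero_eq)
    then have mk: "m \<le> k" by (simp add: zero_less_binomial_iff)
    have n0: "real n > 0" using n by simp
    have "2 powr ((0.694 - \<epsilon>) * real n) = (2 powr 0.694) ^ n / 2 powr (\<epsilon> * real n)"
      by (simp add: powr_diff algebra_simps powr_power)
    also have "\<dots> \<le> 1.618 ^ n / real n"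
      using n1[of n] n n0 two_powr_le by (intro frac_le power_mono) auto
    finally have "c * (2 powr ((0.694 - \<epsilon>) * real n) / sqrt (real n)) \<le> c * (1.618 ^ n / real n / sqrt (real n))"
      by (intro mult_left_mono divide_right_mono) (auto simp: c_def)
    also have "\<dots> \<le> c * (1.618 ^ n / real n / 1)"
      using n by (intro mult_left_mono divide_left_mono) (auto simp: c_def)
    also have "(1.618::real) ^ n = 1.618 ^ 3 * 1.618 ^ (n - 3)"
      using n by (simp only: flip: power_add) simp
    also have "c * (1.618 ^ 3 * 1.618 ^ (n - 3) / real n / 1) = 1.618 ^ (n - 3) / real n"
      unfolding c_def by simp
    also have "\<dots> \<le> real (k choose m)"
    proof -
      have "real (fib (n - 1)) \<le> real ((n - 1) * (k choose m))"
        using m(2) by (simp only: of_nat_le_iff k_def)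
      then have "1.618 ^ (n - 3) \<le> real (n - 1) * real (k choose m)"
        using fib by (simp only: of_nat_mult)
      also have "\<dots> \<le> real n * real (k choose m)" by (intro mult_right_mono) auto
      finally show ?thesis using n0 by (simp add: divide_le_eq mult.commute)
    qed
    finally have bound: "c * (2 powr ((0.694 - \<epsilon>) * real n) / sqrt (real n)) \<le> real (k choose m)" .
    define N0 where "N0 = 5 * 4 ^ n * n ^ 3"
    have N0: "N0 > 0" using n by (simp add: N0_def)
    have "\<exists>xs. length xs = n \<and>
       real (tree_width (A n N) xs) \<ge> c * (2 powr ((0.694 - \<epsilon>) * real n) / sqrt (real n))"
      if N: "N \<ge> N0" for N
    proof -
      have "N > 0" using N N0 by simp
      then have "is_bt_algorithm n (A n N)" "adaptive n (A n N)" "solves_knapsack n N (A n N)"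
        using A by (auto simp: adaptive_bt_solves_knapsack_def)
      from binomial_le_tree_width[OF this nk mk N[unfolded N0_def]]
      obtain xs where "length xs = n" "k choose m \<le> tree_width (A n N) xs" by blast
      then show ?thesis using bound by (intro exI[of _ xs]) (auto intro: order.trans)
    qed
    then show ?thesis using N0 by blast
  qed
  moreover have "c > 0" by (simp add: c_def)
  ultimately show ?thesis by blast
qed

end
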